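(* Let $n\ge1$ and let $\mathcal{F}$ be a family of probability distributions on $\{0,1\}^n$ such that, for every $P\in\mathcal{F}$, the coordinates $Y_1,\dots,Y_n$ of $Y\sim P$ are mutually independent. Then $\mathrm{AUC}$ is a strictly $R^*$-proper scoring function for $\mathcal{F}$.
   Context: $\Xi_n$ is the set of total preorders on $\{1,\dots,n\}$; for $\precsim\,\in\Xi_n$, $i\succsim j$ means $j\precsim i$. The rank vector is $\rho_i(\precsim)=\sum_{j=1}^n\left(\mathbf 1_{j\precsim i}-\mathbf 1_{j\succsim i}\right)$. For $y\in\{0,1\}^n$ let $n_1(y)=\sum_i y_i$, $n_0(y)=n-n_1(y)$, and let $\alpha_i(y)=\dfrac{y_i}{n_0(y)n_1(y)}$ if $n_1(y)\notin\{0,n\}$ and $\alpha_i(y)=0$ otherwise. The empirical area under the curve is $$\mathrm{AUC}(y,\precsim)=\tfrac12+\tfrac12\sum_{i=1}^n\alpha_i(y)\rho_i(\precsim).$$ For a distribution $P$ on $\{0,1\}^n$, $R(P)$ is the total preorder given by $i\precsim j\Leftrightarrow P[Y_i=1]\le P[Y_j=1]$, and $R^*(P)$ is the set of all $\precsim\,\in\Xi_n$ contained in $R(P)$ (i.e. $i\precsim j$ implies that $(i,j)\in R(P)$). A function $s:\{0,1\}^n\times\Xi_n\to\mathbb{R}$ is strictly $R^*$-proper for $\mathcal{F}$ if for all $P\in\mathcal{F}$, all $u\in\Xi_n$ and all $t\in R^*(P)$, $\mathbb{E}_P[s(Y,u)]\le\mathbb{E}_P[s(Y,t)]$, with equality only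 if $u\in R^*(P)$. *)

theory Defs
  imports "HOL-Probability.Probability"
begin

definition total_preorders :: "nat \<Rightarrow> nat rel set" where
  "total_preorders n = {r. preorder_on {1..n} r \<and> total_on {1..n} r}"

(* A preorder r relates i to j, in symbols (i, j) : r, when i is ranked at most as high as j. *)

definition rank_vector :: "nat \<Rightarrow> nat rel \<Rightarrow> nat \<Rightarrow> real" where
  "rank_vector n r i = (\<Sum>j=1..n. of_bool ((j, i) \<in> r) - of_bool ((i, j) \<in> r))"

(* The cube {0,1}^n; its elements are extensional, i.e. "undefined" outside {1..n}, so that it
   has exactly 2^n elements. *)
definition binary_cube :: "nat \<Rightarrow> (nat \<Rightarrow> nat) set" where
  "binary_cube n = {1..n} \<rightarrow>\<^sub>E {0, 1}"

definition num_ones :: "nat \<Rightarrow> (nat \<Rightarrow> nat) \<Rightarrow> nat" where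
  "num_ones n y = (\<Sum>i=1..n. y i)"

(* No truncation occurs for y in the cube, where num_ones n y \<le> n. *)
definition num_zeros :: "nat \<Rightarrow> (nat \<Rightarrow> nat) \<Rightarrow> nat" where
  "num_zeros n y = n - num_ones n y"

definition auc_weight :: "nat \<Rightarrow> (nat \<Rightarrow> nat) \<Rightarrow> nat \<Rightarrow> real" where
  "auc_weight n y i =
     (if num_ones n y \<notin> {0, n} then real (y i) / (real (num_zeros n y) * real (num_ones n y)) else 0)"

definition AUC :: "nat \<Rightarrow> (nat \<Rightarrow> nat) \<Rightarrow> nat rel \<Rightarrow> real" where
  "AUC n y r = 1 / 2 + 1 / 2 * (\<Sum>i=1..n. auc_weight n y i * rank_vector n r i)"

(* Every probability distribution on the finite set {0,1}^n is discrete, hence given by a pmf. *)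
definition cube_distributions :: "nat \<Rightarrow> (nat \<Rightarrow> nat) pmf set" where
  "cube_distributions n = {P. set_pmf P \<subseteq> binary_cube n}"

definition ranking :: "nat \<Rightarrow> (nat \<Rightarrow> nat) pmf \<Rightarrow> nat rel" where
  "ranking n P = {(i, j). i \<in> {1..n} \<and> j \<in> {1..n} \<and>
     measure_pmf.prob P {y. y i = 1} \<le> measure_pmf.prob P {y. y j = 1}}"

lemma ranking_total_preorder: "ranking n P \<in> total_preorders n"
  unfolding total_preorders_def ranking_def preorder_on_def refl_on_def trans_on_def total_on_def
  by auto

definition ranking_refinements :: "nat \<Rightarrow> (nat \<Rightarrow> nat) pmf \<Rightarrow> nat rel set" where
  "ranking_refinements n P = {r \<in> total_preorders n. r \<subseteq> ranking n P}"

definition strictly_ranking_proper ::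
    "nat \<Rightarrow> (nat \<Rightarrow> nat) pmf set \<Rightarrow> ((nat \<Rightarrow> nat) \<Rightarrow> nat rel \<Rightarrow> real) \<Rightarrow> bool" where
  "strictly_ranking_proper n F s \<longleftrightarrow>
     (\<forall>P\<in>F. \<forall>u\<in>total_preorders n. \<forall>t\<in>ranking_refinements n P.
        measure_pmf.expectation P (\<lambda>y. s y u) \<le> measure_pmf.expectation P (\<lambda>y. s y t) \<and>
        (measure_pmf.expectation P (\<lambda>y. s y u) = measure_pmf.expectation P (\<lambda>y. s y t)
           \<longrightarrow> u \<in> ranking_refinements n P))"

end

theory Submission
  imports Defs
begin

text \<open>
  With \<open>a i\<close> the expected weight of coordinate \<open>i\<close>, antisymmetry of the pairwise comparisons turns
  the expected AUC of \<open>r\<close> into an affine function of a sum over pairs of \<open>\<plusminus>(a i - a j)\<close> or \<open>0\<close>,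
  which is maximal exactly when \<open>r\<close> orders no pair against \<open>a\<close>.  On the cube,
  \<open>\<alpha>\<^sub>i - \<alpha>\<^sub>j = (y\<^sub>i - y\<^sub>j) / ((1 + S) (n - 1 - S))\<close>, where \<open>S\<close> is the sum of the remaining coordinates.
  By independence \<open>a i - a j\<close> is therefore a positive multiple of \<open>P[Y\<^sub>i = 1] - P[Y\<^sub>j = 1]\<close>.
\<close>

definition rank_comparison :: "nat rel \<Rightarrow> nat \<Rightarrow> nat \<Rightarrow> real" where
  "rank_comparison r i j = of_bool ((j, i) \<in> r) - of_bool ((i, j) \<in> r)"

lemma rank_comparison_swap: "rank_comparison r j i = - rank_comparison r i j"
  by (simp add: rank_comparison_def)

text \<open>Swapping the two summations and using antisymmetry gives the same sum with
  \<open>- a j\<close> in place of \<open>a i\<close>. Adding the two forms produces the differences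
  \<open>a i - a j\<close> and the factor 2.\<close>

lemma sum_weight_rank_vector:
  fixes a :: "nat \<Rightarrow> real"
  shows "2 * (\<Sum>i=1..n. a i * rank_vector n r i) =
    (\<Sum>(i, j)\<in>{1..n} \<times> {1..n}. (a i - a j) * rank_comparison r i j)"
proof -
  have 1: "(\<Sum>i=1..n. a i * rank_vector n r i) = (\<Sum>i=1..n. \<Sum>j=1..n. a i * rank_comparison r i j)"
    by (simp add: rank_vector_def rank_comparison_def sum_distrib_left)
  also have "\<dots> = (\<Sum>i=1..n. \<Sum>j=1..n. a j * rank_comparison r j i)"
    by (rule sum.swap)
  also have "\<dots> = (\<Sum>i=1..n. \<Sum>j=1..n. - (a j * rank_comparison r i j))"
    by (simp add: rank_comparison_swap[of r _ i for i] rank_comparison_def algebra_simps)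
  finally show ?thesis
    using 1 by (simp add: sum.cartesian_product[symmetric] left_diff_distrib sum_subtractf sum_negf)
qed

lemma weight_diff_times_rank_comparison_le:
  fixes a :: "nat \<Rightarrow> real"
  shows "(a i - a j) * rank_comparison r i j \<le> \<bar>a i - a j\<bar>"
  by (auto simp: rank_comparison_def)

text \<open>The comparison is 1, -1 or 0, and a tie forces \<open>a i = a j\<close>. The assumption
  rules out incomparable distinct pairs, whose comparison is also 0 although the right-hand side
  holds vacuously. The case \<open>i = j\<close> is listed because \<open>total_on\<close> speaks of
  distinct elements only.\<close>

lemma weight_diff_times_rank_comparison_eq_iff:
  fixes a :: "nat \<Rightarrow> real"
  assumes "(i, j) \<in> r \<or> (j, i) \<in> r \<or> i = j"
  shows "(a i - a j) * rank_comparison r i j = \<bar>a i - a j\<bar> \<longleftrightarrow>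
    ((i, j) \<in> r \<longrightarrow> a i \<le> a j) \<and> ((j, i) \<in> r \<longrightarrow> a j \<le> a i)"
  using assms by (auto simp: rank_comparison_def)

text \<open>The bound does not depend on \<open>r\<close>, so it serves as the common maximum over
  all rankings.\<close>

lemma sum_weight_rank_vector_le:
  fixes a :: "nat \<Rightarrow> real"
  shows "2 * (\<Sum>i=1..n. a i * rank_vector n r i) \<le> (\<Sum>(i, j)\<in>{1..n} \<times> {1..n}. \<bar>a i - a j\<bar>)"
  unfolding sum_weight_rank_vector
  by (intro sum_mono) (auto intro: weight_diff_times_rank_comparison_le)

lemma sum_weight_rank_vector_eq_iff:
  fixes a :: "nat \<Rightarrow> real"
  assumes "r \<in> total_preorders n"
  shows "2 * (\<Sum>i=1..n. a i * rank_vector n r i) = (\<Sum>(i, j)\<in>{1..n} \<times> {1..n}. \<bar>a i - a j\<bar>) \<longleftrightarrow>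
    r \<subseteq> {(i, j). a i \<le> a j}"
proof -
  let ?A = "{1..n} \<times> {1..n}"
  have r: "r \<subseteq> ?A" "total_on {1..n} r"
    using assms by (auto simp: total_preorders_def preorder_on_def)
  have "2 * (\<Sum>i=1..n. a i * rank_vector n r i) = (\<Sum>(i, j)\<in>?A. \<bar>a i - a j\<bar>) \<longleftrightarrow>
      (\<forall>(i, j)\<in>?A. (a i - a j) * rank_comparison r i j = \<bar>a i - a j\<bar>)"
    unfolding sum_weight_rank_vector
  proof
    assume eq: "(\<Sum>(i, j)\<in>?A. (a i - a j) * rank_comparison r i j) = (\<Sum>(i, j)\<in>?A. \<bar>a i - a j\<bar>)"
    show "\<forall>(i, j)\<in>?A. (a i - a j) * rank_comparison r i j = \<bar>a i - a j\<bar>"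
      \<comment> \<open>Each term on the left is at most its counterpart, so equal finite sums force
        equality term by term.\<close>
      using sum_mono_inv[OF eq] weight_diff_times_rank_comparison_le by fastforce
  qed (auto intro!: sum.cong)
  also have "\<dots> \<longleftrightarrow> (\<forall>(i, j)\<in>?A. ((i, j) \<in> r \<longrightarrow> a i \<le> a j) \<and> ((j, i) \<in> r \<longrightarrow> a j \<le> a i))"
    using r(2) weight_diff_times_rank_comparison_eq_iff[of _ _ r a]
    unfolding total_on_def by (intro ball_cong refl) (auto simp del: mult_eq_0_iff)
  also have "\<dots> \<longleftrightarrow> r \<subseteq> {(i, j). a i \<le> a j}"
    using r(1) by fast
  finally show ?thesis .
qed

lemma finite_set_pmf_cube_distribution:
  assumes "P \<in> cube_distributions n"
  shows "finite (set_pmf P)"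
  using assms finite_subset[of "set_pmf P" "binary_cube n"]
  by (auto simp: cube_distributions_def binary_cube_def intro!: finite_PiE)

lemma expectation_AUC:
  assumes "P \<in> cube_distributions n"
  shows "measure_pmf.expectation P (\<lambda>y. AUC n y r) =
    1 / 2 + 1 / 2 * (\<Sum>i=1..n. measure_pmf.expectation P (\<lambda>y. auc_weight n y i) * rank_vector n r i)"
proof -
  have [simp]: "integrable P f" for f :: "(nat \<Rightarrow> nat) \<Rightarrow> real"
    using finite_set_pmf_cube_distribution[OF assms] by (rule integrable_measure_pmf_finite)
  show ?thesis
    by (simp add: AUC_def)
qed

text \<open>If \<open>y i = y j\<close>, both sides vanish. Otherwise exactly one of the two is 1,
  so there are \<open>1 + S\<close> ones and \<open>n - 1 - S\<close> zeros. The second factor thus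
  depends only on the other coordinates, and the bounds on \<open>S\<close> make it
  positive.\<close>

lemma auc_weight_diff:
  assumes "y \<in> binary_cube n" "i \<in> {1..n}" "j \<in> {1..n}" "i \<noteq> j"
  defines "S \<equiv> \<Sum>k\<in>{1..n} - {i, j}. real (y k)"
  shows "auc_weight n y i - auc_weight n y j = (real (y i) - real (y j)) * (1 / ((1 + S) * (real n - 1 - S)))"
    and "0 \<le> S" "S \<le> real n - 2"
proof -
  have y01: "y k = 0 \<or> y k = 1" if "k \<in> {1..n}" for k
    using assms(1) that by (auto simp: binary_cube_def PiE_iff)
  have "{1..n} = insert i (insert j ({1..n} - {i, j}))"
    using assms by auto
  then have ones: "real (num_ones n y) = real (y i) + real (y j) + S"
    unfolding num_ones_def S_def of_nat_sum
    by (metis (no_types, lifting) add.assoc assms(4) Diff_iff finite_Diff finite_atLeastAtMost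
        finite_insert insert_iff sum.insert)
  show "0 \<le> S"
    unfolding S_def by (rule sum_nonneg) simp
  have card: "card ({1..n} - {i, j}) = n - 2" and "2 \<le> n"
    using assms card_mono[of "{1..n}" "{i, j}"] by (auto simp: card_Diff_subset)
  have "S \<le> (\<Sum>k\<in>{1..n} - {i, j}. 1)"
    unfolding S_def using y01 by (intro sum_mono) fastforce
  then show "S \<le> real n - 2"
    using card \<open>2 \<le> n\<close> by (simp add: of_nat_diff)
  show "auc_weight n y i - auc_weight n y j = (real (y i) - real (y j)) * (1 / ((1 + S) * (real n - 1 - S)))"
  proof (cases "y i = y j")
    case True
    then show ?thesis by (simp add: auc_weight_def)
  next
    case False
    with y01 assms have ij: "y i = 0 \<and> y j = 1 \<or> y i = 1 \<and> y j = 0"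
      by metis
    with ones have ones': "real (num_ones n y) = 1 + S"
      by auto
    \<comment> \<open>Both values occur in \<open>y\<close>, so the default weight 0 does not
      arise.\<close>
    with \<open>0 \<le> S\<close> \<open>S \<le> real n - 2\<close> have range: "num_ones n y \<noteq> 0" "num_ones n y < n"
      by linarith+
    then have "real (num_zeros n y) = real n - 1 - S"
      using ones' by (simp add: num_zeros_def of_nat_diff)
    with range ij ones' show ?thesis
      by (auto simp: auc_weight_def mult.commute)
  qed
qed

lemma expectation_coordinate:
  assumes "P \<in> cube_distributions n" "i \<in> {1..n}"
  shows "measure_pmf.expectation P (\<lambda>y. real (y i)) = measure_pmf.prob P {y. y i = 1}"
proof -
  have "measure_pmf.expectation P (\<lambda>y. real (y i)) = measure_pmf.expectation P (indicator {y. y i = 1})"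
  proof (intro integral_cong_AE AE_pmfI)
    fix y assume "y \<in> set_pmf P"
    then have "y i = 0 \<or> y i = 1"
      using assms by (auto simp: cube_distributions_def binary_cube_def PiE_iff dest!: subsetD)
    then show "real (y i) = indicator {y. y i = 1} y"
      by auto
  qed simp_all
  then show ?thesis by simp
qed

text \<open>Since \<open>K\<close> omits \<open>i\<close>, the coordinate \<open>i\<close> and the
  sum over \<open>K\<close> are independent, so the expectation of the product factors.\<close>

lemma expectation_coordinate_times_rest:
  fixes g :: "real \<Rightarrow> real"
  assumes "P \<in> cube_distributions n"
    and indep: "prob_space.indep_vars (measure_pmf P) (\<lambda>_. count_space UNIV) (\<lambda>i y. y i) {1..n}"
    and "i \<in> {1..n}" "K \<subseteq> {1..n} - {i}" and g: "g \<in> borel_measurable borel"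
  shows "measure_pmf.expectation P (\<lambda>y. real (y i) * g (\<Sum>k\<in>K. real (y k))) =
    measure_pmf.prob P {y. y i = 1} * measure_pmf.expectation P (\<lambda>y. g (\<Sum>k\<in>K. real (y k)))"
proof -
  have int: "integrable P f" for f :: "(nat \<Rightarrow> nat) \<Rightarrow> real"
    using finite_set_pmf_cube_distribution[OF assms(1)] by (rule integrable_measure_pmf_finite)
  have "prob_space.indep_vars (measure_pmf P) (\<lambda>_. borel) (\<lambda>i y. real (y i)) {1..n}"
    using prob_space.indep_vars_compose2[OF prob_space_measure_pmf indep, of "\<lambda>_. real" "\<lambda>_. borel"] by simp
  then have "prob_space.indep_vars (measure_pmf P) (\<lambda>_. borel) (\<lambda>i y. real (y i)) (insert i K)"
    by (rule prob_space.indep_vars_subset[OF prob_space_measure_pmf]) (use assms in auto)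
  then have "prob_space.indep_var (measure_pmf P) borel (\<lambda>y. real (y i)) borel (\<lambda>y. \<Sum>k\<in>K. real (y k))"
    using assms finite_subset[of K "{1..n} - {i}"] by (intro prob_space.indep_vars_sum[OF prob_space_measure_pmf]) auto
  then have "prob_space.indep_var (measure_pmf P) borel (id \<circ> (\<lambda>y. real (y i))) borel (g \<circ> (\<lambda>y. \<Sum>k\<in>K. real (y k)))"
    using g by (intro prob_space.indep_var_compose[OF prob_space_measure_pmf]) (auto simp: id_def)
  from prob_space.indep_var_lebesgue_integral[OF prob_space_measure_pmf this int int] show ?thesis
    by (simp add: expectation_coordinate[OF assms(1,3)])
qed

lemma expected_auc_weight_le_iff:
  assumes P: "P \<in> cube_distributions n"
    and indep: "prob_space.indep_vars (measure_pmf P) (\<lambda>_. count_space UNIV) (\<lambda>i y. y i) {1..n}"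
    and ij: "i \<in> {1..n}" "j \<in> {1..n}"
  shows "measure_pmf.expectation P (\<lambda>y. auc_weight n y i) \<le> measure_pmf.expectation P (\<lambda>y. auc_weight n y j) \<longleftrightarrow>
    measure_pmf.prob P {y. y i = 1} \<le> measure_pmf.prob P {y. y j = 1}"
proof (cases "i = j")
  case False
  have fin: "finite (set_pmf P)"
    using P by (rule finite_set_pmf_cube_distribution)
  have int [simp]: "integrable P f" for f :: "(nat \<Rightarrow> nat) \<Rightarrow> real"
    using fin by (rule integrable_measure_pmf_finite)
  have cube: "y \<in> binary_cube n" if "y \<in> set_pmf P" for y
    using P that by (auto simp: cube_distributions_def)
  \<comment> \<open>\<open>K\<close> omits both indices, so the same factor \<open>h\<close> can be
    split off from coordinate \<open>i\<close> and from coordinate \<open>j\<close>.\<close>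
  define K where "K = {1..n} - {i, j}"
  have K: "K \<subseteq> {1..n} - {i}" "K \<subseteq> {1..n} - {j}"
    by (auto simp: K_def)
  define g :: "real \<Rightarrow> real" where "g s = 1 / ((1 + s) * (real n - 1 - s))" for s
  define h where "h y = g (\<Sum>k\<in>K. real (y k))" for y
  define c where "c = measure_pmf.expectation P h"
  have g: "g \<in> borel_measurable borel"
    unfolding g_def by measurable
  \<comment> \<open>On the cube both factors in the denominator of \<open>g\<close> are at least
    1.\<close>
  have "h y > 0" if "y \<in> set_pmf P" for y
    using auc_weight_diff(2,3)[OF cube[OF that] ij False] by (auto simp: h_def g_def K_def)
  then have "c > 0"
    unfolding c_def using fin set_pmf_not_empty[of P]
    by (subst integral_measure_pmf[OF fin]) (auto intro!: sum_pos simp: pmf_positive)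
  have "measure_pmf.expectation P (\<lambda>y. auc_weight n y i) - measure_pmf.expectation P (\<lambda>y. auc_weight n y j)
      = measure_pmf.expectation P (\<lambda>y. auc_weight n y i - auc_weight n y j)"
    by simp
  \<comment> \<open>The formula for the difference of weights holds on the cube, hence almost surely
    under \<open>P\<close>.\<close>
  also have "\<dots> = measure_pmf.expectation P (\<lambda>y. real (y i) * h y - real (y j) * h y)"
    using auc_weight_diff(1)[OF cube ij False]
    by (intro integral_cong_AE) (auto simp: AE_measure_pmf_iff h_def g_def K_def diff_divide_distrib)
  also have "\<dots> = (measure_pmf.prob P {y. y i = 1} - measure_pmf.prob P {y. y j = 1}) * c"
    unfolding c_def h_def
    using K expectation_coordinate_times_rest[OF P indep ij(1) _ g, of K]
      expectation_coordinate_times_rest[OF P indep ij(2) _ g, of K]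
    by (subst Bochner_Integration.integral_diff) (auto simp: left_diff_distrib)
  finally have diff: "measure_pmf.expectation P (\<lambda>y. auc_weight n y i)
      - measure_pmf.expectation P (\<lambda>y. auc_weight n y j) =
    (measure_pmf.prob P {y. y i = 1} - measure_pmf.prob P {y. y j = 1}) * c" .
  have "a \<le> b \<longleftrightarrow> p \<le> q" if "a - b = (p - q) * c" for a b p q :: real
    using that \<open>c > 0\<close> mult_le_0_iff[of "p - q" c] by auto
  from this[OF diff] show ?thesis .
qed simp

theorem theorem5:
  fixes n :: nat and F :: "(nat \<Rightarrow> nat) pmf set"
  assumes "n \<ge> 1"
    and "F \<subseteq> cube_distributions n"
    and "\<And>P. P \<in> F \<Longrightarrow>
           prob_space.indep_vars (measure_pmf P) (\<lambda>_. count_space UNIV) (\<lambda>i y. y i) {1..n}"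
  shows "strictly_ranking_proper n F (AUC n)"
  unfolding strictly_ranking_proper_def
proof (intro ballI)
  fix P u t
  assume "P \<in> F" and u: "u \<in> total_preorders n" and t: "t \<in> ranking_refinements n P"
  then have P: "P \<in> cube_distributions n"
    and indep: "prob_space.indep_vars (measure_pmf P) (\<lambda>_. count_space UNIV) (\<lambda>i y. y i) {1..n}"
    using assms by auto
  define a where "a i = measure_pmf.expectation P (\<lambda>y. auc_weight n y i)" for i
  define W where "W r = (\<Sum>i=1..n. a i * rank_vector n r i)" for r
  define B where "B = (\<Sum>(i, j)\<in>{1..n} \<times> {1..n}. \<bar>a i - a j\<bar>)"
  have E: "measure_pmf.expectation P (\<lambda>y. AUC n y r) = 1 / 2 + 1 / 2 * W r" for r
    using expectation_AUC[OF P] by (simp add: W_def a_def)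
  have le: "2 * W r \<le> B" for r
    unfolding W_def B_def by (rule sum_weight_rank_vector_le)
  have eq: "2 * W r = B \<longleftrightarrow> r \<in> ranking_refinements n P" if r: "r \<in> total_preorders n" for r
  proof -
    have sub: "r \<subseteq> {1..n} \<times> {1..n}"
      using r by (simp add: total_preorders_def preorder_on_def)
    have "2 * W r = B \<longleftrightarrow> r \<subseteq> {(i, j). a i \<le> a j}"
      unfolding W_def B_def by (rule sum_weight_rank_vector_eq_iff[OF r])
    \<comment> \<open>Restricting to \<open>{1..n}\<close> prepares the next step: only there are
      \<open>a\<close> and the marginal probabilities known to induce the same order.\<close>
    also have "\<dots> \<longleftrightarrow> r \<subseteq> {(i, j). i \<in> {1..n} \<and> j \<in> {1..n} \<and> a i \<le> a j}"
      using sub by blast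
    also have "{(i, j). i \<in> {1..n} \<and> j \<in> {1..n} \<and> a i \<le> a j} = ranking n P"
      unfolding ranking_def a_def using expected_auc_weight_le_iff[OF P indep] by blast
    finally show ?thesis
      using r by (simp add: ranking_refinements_def)
  qed
  \<comment> \<open>\<open>t\<close> attains the universal bound \<open>B\<close>, so
    \<open>u\<close> can at best match it, and it does so exactly when it is itself a
    refinement.\<close>
  have "2 * W t = B"
    using t eq by (simp add: ranking_refinements_def)
  then show "measure_pmf.expectation P (\<lambda>y. AUC n y u) \<le> measure_pmf.expectation P (\<lambda>y. AUC n y t) \<and>
      (measure_pmf.expectation P (\<lambda>y. AUC n y u) = measure_pmf.expectation P (\<lambda>y. AUC n y t)
        \<longrightarrow> u \<in> ranking_refinements n P)"
    using le[of u] eq[OF u] unfolding E by auto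
qed

end
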